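(* Let $d\ge 2$ be an integer. For all $n\ge 2d+2$, we have $$D_d(n)\lesssim\sqrt{2(d+1)n}.$$ Here $f(n)\lesssim g(n)$ means $f(n)\le (1+o(1))\,g(n)$, where the $o(1)$ term tends to $0$ as $n\to\infty$ with $d$ fixed.
   Context: An arrangement (finite set) of at least $d+1$ hyperplanes in $\mathbb{R}^d$ is in general position if every $d$ of the hyperplanes meet in a single point and no $d+1$ of them have a common point. Any $d+1$ hyperplanes of such an arrangement determine a $d$-dimensional simplex, whose vertices are the $d+1$ intersection points of the $d$-element subfamilies. $D_d(n)$ denotes the largest integer $t$ such that every arrangement of $n$ hyperplanes in general position in $\mathbb{R}^d$ contains a subset of $t$ hyperplanes for which all the $d$-dimensional simplices determined by its $(d+1)$-element subsets have pairwise distinct $d$-dimensional volumes. *)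

theory Defs
  imports "HOL-Analysis.Analysis"
begin

text \<open>
  The space \<open>\<real>\<^sup>d\<close> is rendered as \<^typ>\<open>real ^ 'd\<close>, with \<open>d = CARD('d)\<close>.
\<close>

definition hyperplane :: "(real ^ 'd) set \<Rightarrow> bool" where
  "hyperplane H \<longleftrightarrow> (\<exists>a b. a \<noteq> 0 \<and> H = {x. a \<bullet> x = b})"

definition general_position :: "(real ^ 'd) set set \<Rightarrow> bool" where
  "general_position A \<longleftrightarrow>
     finite A \<and> card A \<ge> CARD('d) + 1 \<and> (\<forall>H\<in>A. hyperplane H) \<and>
     (\<forall>T. T \<subseteq> A \<and> card T = CARD('d) \<longrightarrow> (\<exists>p. \<Inter>T = {p})) \<and>
     (\<forall>T. T \<subseteq> A \<and> card T = CARD('d) + 1 \<longrightarrow> \<Inter>T = {})"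

definition simplex_vertices :: "(real ^ 'd) set set \<Rightarrow> (real ^ 'd) set" where
  "simplex_vertices S = {p. \<exists>T. T \<subseteq> S \<and> card T = CARD('d) \<and> p \<in> \<Inter>T}"

definition simplex_volume :: "(real ^ 'd) set set \<Rightarrow> real" where
  "simplex_volume S = measure lebesgue (convex hull (simplex_vertices S))"

definition distinct_volumes :: "(real ^ 'd) set set \<Rightarrow> bool" where
  "distinct_volumes B \<longleftrightarrow> inj_on simplex_volume {S. S \<subseteq> B \<and> card S = CARD('d) + 1}"

text \<open>
  The dimension enters through a type argument.  The number is meaningful only for
  \<open>n \<ge> d + 1\<close>: below that bound there are no arrangements of \<open>n\<close> hyperplanes in general
  position, every \<open>t\<close> qualifies vacuously, and \<^const>\<open>Greatest\<close> is unspecified.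
\<close>

definition D :: "'d::finite itself \<Rightarrow> nat \<Rightarrow> nat" where
  "D _ n = (GREATEST t. \<forall>A :: (real ^ 'd) set set.
     general_position A \<and> card A = n \<longrightarrow>
       (\<exists>B. B \<subseteq> A \<and> card B = t \<and> distinct_volumes B))"

end

theory Submission imports Defs begin

text \<open>
  Identify a point of \<open>\<real>\<^sup>d\<close> with the monic polynomial of degree \<open>d\<close> whose lower coefficients
  are its coordinates, and let \<open>H\<^sub>t\<close> be the hyperplane of the polynomials with root \<open>t\<close>. Since a
  monic polynomial of degree \<open>d\<close> is determined by \<open>d\<close> distinct roots and has no more than \<open>d\<close>
  of them, distinct \<open>H\<^sub>t\<close> are in general position. The substitution \<open>X \<mapsto> X - s\<close> is an affine
  map with unitriangular linear part, so it preserves volumes, and it maps \<open>H\<^sub>t\<close> onto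
  \<open>H\<^bsub>t+s\<^esub>\<close>. Take the arrangement \<open>H\<^sub>0, \<dots>, H\<^bsub>n-1\<^esub>\<close>. If a subset of it contains \<open>d + 1\<close> pairs
  with the same index difference \<open>s > 0\<close>, then the substitution maps one simplex onto a
  different one, and the two have equal volumes. A subset of \<open>t\<close> hyperplanes with
  distinct volumes therefore has at most \<open>d\<close> pairs for each of the \<open>n - 1\<close> differences,
  so \<open>t(t - 1)/2 \<le> d(n - 1)\<close>.
\<close>

section \<open>Unitriangular maps preserve volume\<close>

text \<open>
  The linear change of variables formula of the library needs a well-ordered index type.
  This copy of the index type inherits the order of the natural numbers.
\<close>

typedef (overloaded) 'n::finite index = "{..<CARD('n)}"
  using zero_less_card_finite[where 'a='n] by blast

instantiation index :: (finite) wellorder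
begin

definition less_eq_index :: "'a index \<Rightarrow> 'a index \<Rightarrow> bool" where
  "i \<le> j \<longleftrightarrow> Rep_index i \<le> Rep_index j"

definition less_index :: "'a index \<Rightarrow> 'a index \<Rightarrow> bool" where
  "i < j \<longleftrightarrow> Rep_index i < Rep_index j"

instance
proof
  fix P :: "'a index \<Rightarrow> bool" and a :: "'a index"
  assume step: "\<And>x. (\<And>y. y < x \<Longrightarrow> P y) \<Longrightarrow> P x"
  show "P a"
    by (induction a rule: measure_induct_rule[of Rep_index]) (auto intro: step simp: less_index_def)
qed (auto simp: less_eq_index_def less_index_def Rep_index_inject)

end

instance index :: (finite) finite
proof
  have "finite (Abs_index ` {..<CARD('a)} :: 'a index set)" by simp
  then show "finite (UNIV :: 'a index set)"
    using type_definition.Abs_image[OF type_definition_index[where 'n='a]] by simp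
qed

lemma prod_Basis_cart:
  "(\<Prod>b\<in>Basis. (x :: real ^ 'n) \<bullet> b) = (\<Prod>i\<in>UNIV. x $ i)"
proof -
  have "bij_betw (\<lambda>i. axis i 1 :: real ^ 'n) UNIV Basis"
    by (auto simp: bij_betw_def inj_def axis_eq_axis Basis_vec_def)
  from prod.reindex_bij_betw[OF this, of "(\<bullet>) x"] show ?thesis
    by (simp add: inner_axis)
qed

text \<open>Relabelling coordinates pulls boxes back to boxes with the same side lengths in another
  order, and Lebesgue measure is determined by its values on boxes.\<close>

lemma lborel_reindex_cart:
  fixes h :: "'m::finite \<Rightarrow> 'n::finite"
  assumes "bij h"
  shows "distr lborel borel (\<lambda>x :: real ^ 'n. \<chi> i. x $ h i) = lborel"
proof (rule lborel_eqI[symmetric])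
  let ?f = "\<lambda>x :: real ^ 'n. (\<chi> i. x $ h i) :: real ^ 'm"
  have [measurable]: "?f \<in> borel \<rightarrow>\<^sub>M borel"
    by (intro borel_measurable_continuous_onI continuous_intros)
  fix l u :: "real ^ 'm"
  assume le: "\<And>b. b \<in> Basis \<Longrightarrow> l \<bullet> b \<le> u \<bullet> b"
  have le': "l $ i \<le> u $ i" for i
    using le[of "axis i 1"] by (auto simp: inner_axis axis_in_Basis_iff)
  let ?l = "\<chi> j. l $ inv h j" and ?u = "\<chi> j. u $ inv h j"
  have inv: "inv h (h i) = i" "h (inv h j) = j" for i j
    using assms by (auto simp: bij_def surj_f_inv_f)
  have all: "(\<forall>i. Q i (h i)) \<longleftrightarrow> (\<forall>j. Q (inv h j) j)" for Q
    using inv by metis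
  have "?f x \<in> box l u \<longleftrightarrow> x \<in> box ?l ?u" for x
    using all[of "\<lambda>i j. l $ i < x $ j \<and> x $ j < u $ i"] by (simp add: mem_box_cart)
  then have "?f -` box l u = box ?l ?u" by blast
  then have "emeasure (distr lborel borel ?f) (box l u) = emeasure lborel (box ?l ?u)"
    by (simp add: emeasure_distr)
  also have "\<dots> = (\<Prod>b\<in>Basis. (?u - ?l) \<bullet> b)"
    using le' by (intro emeasure_lborel_box) (auto simp: Basis_vec_def inner_axis)
  also have "\<dots> = (\<Prod>j\<in>UNIV. (u - l) $ inv h j)"
    by (simp add: prod_Basis_cart)
  also have "\<dots> = (\<Prod>i\<in>UNIV. (u - l) $ i)"
    using prod.reindex_bij_betw[OF bij_imp_bij_inv[OF assms], of "\<lambda>i. (u - l) $ i"] by simp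
  finally show "emeasure (distr lborel borel ?f) (box l u) = (\<Prod>b\<in>Basis. (u - l) \<bullet> b)"
    by (simp only: prod_Basis_cart)
qed simp

lemma measure_reindex_cart:
  fixes h :: "'m::finite \<Rightarrow> 'n::finite" and S :: "(real ^ 'n) set"
  assumes "bij h" "compact S"
  shows "measure lebesgue ((\<lambda>x. \<chi> i. x $ h i) ` S) = measure lebesgue S"
proof -
  let ?f = "\<lambda>x :: real ^ 'n. (\<chi> i. x $ h i) :: real ^ 'm"
  have cont: "continuous_on A ?f" for A
    by (intro continuous_intros)
  have [measurable]: "?f \<in> borel \<rightarrow>\<^sub>M borel"
    by (intro borel_measurable_continuous_onI cont)
  have compact: "compact (?f ` S)"
    using cont assms(2) by (rule compact_continuous_image)
  have "inj ?f"
  proof (rule injI)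
    fix x y assume "?f x = ?f y"
    then have "x $ h i = y $ h i" for i
      by (simp add: vec_eq_iff)
    then show "x = y"
      using bij_is_surj[OF assms(1)] by (metis surjD vec_eq_iff)
  qed
  then have "?f -` ?f ` S = S"
    by (rule inj_vimage_image_eq)
  moreover have "measure lborel (?f ` S) = measure (distr lborel borel ?f) (?f ` S)"
    using assms(1) by (simp add: lborel_reindex_cart)
  moreover have "\<dots> = measure lborel (?f -` ?f ` S)"
    using compact by (subst measure_distr) (auto intro: borel_compact)
  ultimately have "measure lborel (?f ` S) = measure lborel S" by simp
  then show ?thesis
    using compact assms(2) by (simp add: measure_completion borel_compact)
qed

text \<open>Listing the coordinates in the order given by \<open>r\<close> turns the matrix of
  \<open>f\<close> into an upper triangular one with ones on the diagonal. Its determinant is 1, and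
  the relabelling itself preserves volume.\<close>

lemma measure_unitriangular_image:
  fixes f :: "real ^ 'n::finite \<Rightarrow> real ^ 'n" and r :: "'n \<Rightarrow> nat"
  assumes "linear f" and r: "bij_betw r UNIV {..<CARD('n)}"
    and lower: "\<And>i j. r j < r i \<Longrightarrow> f (axis j 1) $ i = 0"
    and diag: "\<And>i. f (axis i 1) $ i = 1"
    and S: "compact S"
  shows "measure lebesgue (f ` S) = measure lebesgue S"
proof -
  define h :: "'n index \<Rightarrow> 'n" where "h i = inv_into UNIV r (Rep_index i)" for i
  have rh: "r (h i) = Rep_index i" for i
    using r Rep_index[of i] unfolding h_def by (intro f_inv_into_f) (auto simp: bij_betw_def)
  have "bij_betw Rep_index (UNIV :: 'n index set) {..<CARD('n)}"
    using type_definition.Rep_range[OF type_definition_index[where 'n='n]]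
    by (auto simp: bij_betw_def inj_def Rep_index_inject)
  from bij_betw_trans[OF this bij_betw_inv_into[OF r]] have h: "bij h"
    by (simp add: h_def[abs_def] o_def)
  let ?to = "\<lambda>x :: real ^ 'n. (\<chi> i. x $ h i) :: real ^ 'n index"
  let ?of = "\<lambda>y :: real ^ 'n index. (\<chi> j. y $ inv h j) :: real ^ 'n"
  have inv: "inv h (h i) = i" "h (inv h j) = j" for i j
    using h by (auto simp: bij_def surj_f_inv_f)
  \<comment> \<open>\<open>g\<close> is \<open>f\<close> conjugated to the ordered index type, where
    triangularity makes sense.\<close>
  define g where "g = ?to \<circ> f \<circ> ?of"
  have lin: "linear ?to" "linear ?of"
    by (auto simp: linear_iff vec_eq_iff)
  have "linear g"
    unfolding g_def by (intro linear_compose lin assms(1))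
  have of_axis: "?of (axis i 1) = axis (h i) 1" for i
    by (auto simp: vec_eq_iff axis_def inv)
  have entry: "matrix g $ i $ j = f (axis (h j) 1) $ h i" for i j
    by (simp add: matrix_def g_def of_axis)
  have "det (matrix g) = (\<Prod>i\<in>UNIV. matrix g $ i $ i)"
    by (rule det_upperdiagonal) (auto simp: entry rh less_index_def intro!: lower)
  then have "det (matrix g) = 1"
    by (simp add: entry diag)
  have to_S: "compact (?to ` S)"
    by (intro compact_continuous_image linear_continuous_on S) (simp add: lin(1) flip: linear_conv_bounded_linear)
  have "?to ` f ` S = g ` ?to ` S"
    by (simp add: g_def image_image inv)
  then have "measure lebesgue (?to ` f ` S) = measure lebesgue (?to ` S)"
    using measure_linear_image[OF \<open>linear g\<close> lmeasurable_compact[OF to_S]] \<open>det (matrix g) = 1\<close> by simp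
  moreover have "compact (f ` S)"
    by (intro compact_continuous_image linear_continuous_on S) (simp add: assms(1) flip: linear_conv_bounded_linear)
  ultimately show ?thesis
    using S by (simp add: measure_reindex_cart[OF h])
qed

section \<open>Hyperplanes of polynomials with a prescribed root\<close>

text \<open>The index type carries no order, so an arbitrary enumeration \<open>r\<close> assigns to
  each coordinate the exponent whose coefficient it holds.\<close>

locale coordinate_order =
  fixes r :: "'d::finite \<Rightarrow> nat"
  assumes r: "bij_betw r UNIV {..<CARD('d)}"
begin

definition monic :: "real ^ 'd \<Rightarrow> real poly" where
  "monic x = monom 1 CARD('d) + (\<Sum>k\<in>UNIV. monom (x $ k) (r k))"

text \<open>Discards all coefficients of degree at least d. This makes it linear on all polynomials,
  and inverse to \<open>monic\<close> on the monic ones of degree d.\<close>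

definition coords :: "real poly \<Rightarrow> real ^ 'd" where
  "coords p = (\<chi> k. coeff p (r k))"

definition root_plane :: "real \<Rightarrow> (real ^ 'd) set" where
  "root_plane t = {x. poly (monic x) t = 0}"

definition shift :: "real \<Rightarrow> real ^ 'd \<Rightarrow> real ^ 'd" where
  "shift s x = coords (pcompose (monic x) [:- s, 1:])"

lemma r_less: "r k < CARD('d)"
  using r by (auto simp: bij_betw_def)

lemma r_neq [simp]: "r k \<noteq> CARD('d)"
  using r_less by (rule less_imp_neq)

lemma r_eq_iff: "r i = r j \<longleftrightarrow> i = j"
  using r by (auto simp: bij_betw_def inj_def)

lemma coeff_sum_monom: "coeff (\<Sum>k\<in>UNIV. monom (x $ k) (r k)) (r i) = x $ i"
  by (simp add: coeff_sum r_eq_iff)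

lemma coords_monic [simp]: "coords (monic x) = x"
  by (simp add: coords_def monic_def coeff_sum_monom vec_eq_iff r_neq[symmetric] del: r_neq)

lemma coeff_monic_ge: "n \<ge> CARD('d) \<Longrightarrow> coeff (monic x) n = (if n = CARD('d) then 1 else 0)"
  using r_less by (force simp: monic_def coeff_sum intro!: sum.neutral dest: leD)

lemma degree_monic: "degree (monic x) = CARD('d)"
  by (rule antisym) (auto intro!: degree_le le_degree simp: coeff_monic_ge)

lemma monic_coords:
  assumes "degree p = CARD('d)" "lead_coeff p = 1"
  shows "monic (coords p) = p"
proof (rule poly_eqI)
  fix n
  show "coeff (monic (coords p)) n = coeff p n"
  proof (cases "n < CARD('d)")
    case True
    then obtain k where "n = r k"
      using r by (auto simp: bij_betw_def)
    then show ?thesis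
      using coords_monic[of "coords p"] by (simp add: coords_def vec_eq_iff)
  next
    case False
    then show ?thesis
      using assms by (auto simp: coeff_monic_ge coeff_eq_0)
  qed
qed

text \<open>Substituting X - s keeps a polynomial monic of degree d, so \<open>coords\<close> loses
  no information here.\<close>

lemma monic_shift: "monic (shift s x) = pcompose (monic x) [:- s, 1:]"
  unfolding shift_def
proof (rule monic_coords)
  show "degree (pcompose (monic x) [:- s, 1:]) = CARD('d)"
    by (simp add: degree_pcompose degree_monic)
  show "lead_coeff (pcompose (monic x) [:- s, 1:]) = 1"
    by (subst lead_coeff_comp) (auto simp: degree_monic coeff_monic_ge)
qed

lemma shift_shift: "shift s (shift t x) = shift (s + t) x"
proof -
  have "monic (shift s (shift t x)) = monic (shift (s + t) x)"
    by (simp add: monic_shift flip: pcompose_assoc) (simp add: pcompose_pCons add.commute)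
  then show ?thesis by (metis coords_monic)
qed

lemma shift_0: "shift 0 x = x"
  by (simp add: shift_def)

lemma shift_root_plane: "shift s ` root_plane t = root_plane (t + s)"
proof
  \<comment> \<open>Stated for all \<open>s\<close> and \<open>t\<close>, because the reverse
    inclusion is this one applied to the inverse shift.\<close>
  show sub: "shift s ` root_plane t \<subseteq> root_plane (t + s)" for s t
    by (auto simp: root_plane_def monic_shift poly_pcompose)
  have "x = shift s (shift (- s) x)" for x
    by (simp add: shift_shift shift_0)
  moreover have "shift (- s) ` root_plane (t + s) \<subseteq> root_plane t"
    using sub[of "- s" "t + s"] by simp
  ultimately show "root_plane (t + s) \<subseteq> shift s ` root_plane t" by blast
qed

lemma bij_shift: "bij (shift s)"
  by (rule o_bij[of "shift (- s)"]) (auto simp: fun_eq_iff shift_shift shift_0)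

text \<open>The leading monomial contributes the translation \<open>c\<close>, the lower terms the
  linear map \<open>L\<close>. \<open>L\<close> sends the axis vector of \<open>j\<close> to the
  lower coefficients of (X - s)^(r j), which is monic of degree \<open>r j\<close>; hence
  \<open>L\<close> is unitriangular.\<close>

lemma measure_shift_convex_hull:
  assumes "finite V"
  shows "measure lebesgue (convex hull (shift s ` V)) = measure lebesgue (convex hull V)"
proof -
  define L where
    "L x = coords (pcompose (\<Sum>k\<in>UNIV. monom (x $ k) (r k)) [:- s, 1:])" for x
  define c where "c = coords (pcompose (monom 1 CARD('d)) [:- s, 1:])"
  have "shift s x = c + L x" for x
    by (simp add: shift_def monic_def c_def L_def pcompose_add coords_def vec_eq_iff)
  then have shift: "shift s ` V = (+) c ` L ` V"
    by (simp add: image_image)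
  have "linear L"
    by (rule linearI)
       (simp_all add: L_def coords_def vec_eq_iff pcompose_add pcompose_smult sum.distrib
         sum_distrib_left pcompose_sum coeff_sum add_monom[symmetric] smult_monom[symmetric] del: smult_monom)
  have L_axis: "L (axis j 1) $ i = coeff (pcompose (monom 1 (r j)) [:- s, 1:]) (r i)" for i j
  proof -
    have "(\<Sum>k\<in>UNIV. monom (axis j 1 $ k) (r k)) = (\<Sum>k\<in>UNIV. if k = j then monom (1::real) (r k) else 0)"
      by (intro sum.cong) (auto simp: axis_def)
    then show ?thesis by (simp add: L_def coords_def)
  qed
  have deg: "degree (pcompose (monom 1 m) [:- s, 1:]) = m" for m
    by (simp add: degree_pcompose degree_monom_eq)
  have "L (axis j 1) $ i = 0" if "r j < r i" for i j
    using that by (simp add: L_axis coeff_eq_0 deg)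
  moreover have "L (axis i 1) $ i = 1" for i
    using lead_coeff_comp[of "[:- s, 1:]" "monom (1::real) (r i)"]
    by (simp add: L_axis deg degree_monom_eq)
  moreover have "compact (convex hull V)"
    by (intro finite_imp_compact_convex_hull assms)
  ultimately have "measure lebesgue (L ` (convex hull V)) = measure lebesgue (convex hull V)"
    using \<open>linear L\<close> r by (intro measure_unitriangular_image)
  then show ?thesis
    by (simp add: shift convex_hull_translation measure_translation
        convex_hull_linear_image[OF \<open>linear L\<close>])
qed

lemma hyperplane_root_plane: "hyperplane (root_plane t)"
  unfolding hyperplane_def
proof (intro exI conjI)
  \<comment> \<open>The normal vector consists of the powers of \<open>t\<close>. Its entry with
    exponent 0 is 1 even for t = 0, so it never vanishes.\<close>
  have "0 \<in> range r"
    using r by (auto simp: bij_betw_def)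
  then obtain k where "r k = 0" by auto
  then show "(\<chi> k. t ^ r k) \<noteq> 0"
    by (auto simp: vec_eq_iff intro!: exI[of _ k])
  have "poly (monic x) t = t ^ CARD('d) + (\<chi> k. t ^ r k) \<bullet> x" for x
    by (simp add: monic_def poly_sum poly_monom inner_vec_def mult.commute)
  then show "root_plane t = {x. (\<chi> k. t ^ r k) \<bullet> x = - (t ^ CARD('d))}"
    by (simp add: root_plane_def add_eq_0_iff)
qed

lemma inj_root_plane: "inj root_plane"
proof (rule injI, rule ccontr)
  fix s t
  assume eq: "root_plane s = root_plane t" and "s \<noteq> t"
  \<comment> \<open>The polynomial (X - s)^d has \<open>s\<close> as its only root, so it separates
    the two planes.\<close>
  let ?x = "coords ([:- s, 1:] ^ CARD('d))"
  have "monic ?x = [:- s, 1:] ^ CARD('d)"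
    by (rule monic_coords) (simp_all add: degree_linear_power coeff_linear_power)
  then have "?x \<in> root_plane s" "?x \<notin> root_plane t"
    using \<open>s \<noteq> t\<close> by (auto simp: root_plane_def)
  with eq show False by simp
qed

lemma Inter_root_planes:
  assumes "card T = CARD('d)"
  shows "\<Inter>(root_plane ` T) = {coords (\<Prod>t\<in>T. [:- t, 1:])}"
proof -
  let ?p = "\<Prod>t\<in>T. [:- t, 1:]"
  have "finite T"
    using assms by (intro card_ge_0_finite) simp
  have root: "poly ?p z = 0 \<longleftrightarrow> z \<in> T" for z
    using \<open>finite T\<close> by (auto simp: poly_prod prod_zero_iff)
  have deg: "degree ?p = CARD('d)"
    using assms by (subst degree_prod_eq_sum_degree) auto
  have lead: "lead_coeff ?p = 1"
    by (subst lead_coeff_prod) simp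
  have p: "monic (coords ?p) = ?p"
    using deg lead by (rule monic_coords)
  have "x = coords ?p" if x: "x \<in> \<Inter>(root_plane ` T)" for x
  proof -
    have "poly (monic x) z = poly ?p z" if "z \<in> T" for z
    proof -
      from x that have "poly (monic x) z = 0"
        unfolding root_plane_def by blast
      with that root show ?thesis by simp
    qed
    \<comment> \<open>Both polynomials have degree d and leading coefficient 1, so their difference
      has degree below d and d roots.\<close>
    moreover have "coeff (monic x) CARD('d) = coeff ?p CARD('d)"
      using lead unfolding deg by (simp add: coeff_monic_ge)
    ultimately have "monic x = ?p"
      by (intro poly_eqI_degree_lead_coeff[where A = T and n = "CARD('d)"])
        (simp_all only: deg degree_monic assms order_refl)
    then show ?thesis
      using coords_monic[of x] by simp
  qed
  moreover have "coords ?p \<in> \<Inter>(root_plane ` T)"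
    unfolding root_plane_def using root p by simp
  ultimately show ?thesis by blast
qed

text \<open>A common point would be a nonzero polynomial of degree d with d + 1 roots.\<close>

lemma Inter_root_planes_empty:
  assumes "card T = CARD('d) + 1"
  shows "\<Inter>(root_plane ` T) = {}"
proof (rule ccontr)
  assume "\<Inter>(root_plane ` T) \<noteq> {}"
  then obtain x where x: "T \<subseteq> {t. poly (monic x) t = 0}"
    by (auto simp: root_plane_def)
  have "monic x \<noteq> 0"
    using degree_monic[of x] by force
  then have "card T \<le> CARD('d)"
    using card_mono[OF poly_roots_finite x] card_poly_roots_bound[of "monic x"]
    by (simp add: degree_monic)
  with assms show False by simp
qed

lemma general_position_root_planes:
  assumes "finite T" "card T \<ge> CARD('d) + 1"
  shows "general_position (root_plane ` T)"
proof -
  have inj: "inj_on root_plane U" for U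
    using inj_root_plane by (rule inj_on_subset) simp
  have "\<exists>p. \<Inter>F = {p}" if "F \<subseteq> root_plane ` T" "card F = CARD('d)" for F
  proof -
    from that(1) obtain U where "F = root_plane ` U"
      by (meson subset_imageE)
    then show ?thesis
      using that(2) Inter_root_planes[of U] by (auto simp: card_image inj)
  qed
  moreover have "\<Inter>F = {}" if "F \<subseteq> root_plane ` T" "card F = CARD('d) + 1" for F
  proof -
    from that(1) obtain U where "F = root_plane ` U"
      by (meson subset_imageE)
    then show ?thesis
      using that(2) Inter_root_planes_empty[of U] by (simp add: card_image inj)
  qed
  ultimately show ?thesis
    using assms by (auto simp: general_position_def card_image inj hyperplane_root_plane)
qed

end

section \<open>Vertices of simplices and their images under bijections\<close>

lemma finite_simplex_vertices:
  assumes "general_position A" "S \<subseteq> A"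
  shows "finite (simplex_vertices S)"
proof (rule finite_subset)
  show "simplex_vertices S \<subseteq> (\<lambda>T. the_elem (\<Inter>T)) ` Pow A"
  proof
    fix p assume "p \<in> simplex_vertices S"
    then obtain T where T: "T \<subseteq> A" "card T = CARD('a)" "p \<in> \<Inter>T"
      using assms(2) by (auto simp: simplex_vertices_def)
    then obtain q where "\<Inter>T = {q}"
      using assms(1) unfolding general_position_def by blast
    then have "p = the_elem (\<Inter>T)"
      using T(3) by auto
    with T(1) show "p \<in> (\<lambda>T. the_elem (\<Inter>T)) ` Pow A" by blast
  qed
  show "finite ((\<lambda>T. the_elem (\<Inter>T)) ` Pow A)"
    using assms(1) by (simp add: general_position_def)
qed

text \<open>A bijection commutes with intersections and preserves the size of families of sets, so
  it carries vertices to vertices.\<close>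

lemma simplex_vertices_image:
  fixes f :: "real ^ 'd::finite \<Rightarrow> real ^ 'd"
  assumes "bij f"
  shows "simplex_vertices ((`) f ` S) = f ` simplex_vertices S"
proof -
  have "inj f"
    using assms by (rule bij_is_inj)
  then have card: "card ((`) f ` U) = card U" for U
    by (intro card_image inj_onI) (simp add: inj_image_eq_iff)
  have mem: "f p \<in> \<Inter>((`) f ` U) \<longleftrightarrow> p \<in> \<Inter>U" for p U
    using \<open>inj f\<close> by (simp add: inj_image_mem_iff)
  have iff: "f p \<in> simplex_vertices ((`) f ` S) \<longleftrightarrow> p \<in> simplex_vertices S" for p
  proof
    assume "f p \<in> simplex_vertices ((`) f ` S)"
    then obtain T where T: "T \<subseteq> (`) f ` S" "card T = CARD('d)" "f p \<in> \<Inter>T"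
      by (auto simp: simplex_vertices_def)
    from T(1) obtain U where "U \<subseteq> S" "T = (`) f ` U"
      by (meson subset_imageE)
    then show "p \<in> simplex_vertices S"
      using T(2,3) card mem unfolding simplex_vertices_def by auto
  next
    assume "p \<in> simplex_vertices S"
    then obtain U where "U \<subseteq> S" "card U = CARD('d)" "p \<in> \<Inter>U"
      by (auto simp: simplex_vertices_def)
    then have "(`) f ` U \<subseteq> (`) f ` S" "card ((`) f ` U) = CARD('d)" "f p \<in> \<Inter>((`) f ` U)"
      by (auto simp: card)
    then show "f p \<in> simplex_vertices ((`) f ` S)"
      unfolding simplex_vertices_def by blast
  qed
  show ?thesis
  proof (rule set_eqI)
    fix q
    obtain p where "q = f p"
      using bij_is_surj[OF assms] by (rule surjE)
    then show "q \<in> simplex_vertices ((`) f ` S) \<longleftrightarrow> q \<in> f ` simplex_vertices S"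
      using iff \<open>inj f\<close> by (simp add: inj_image_mem_iff)
  qed
qed

section \<open>Repeated differences\<close>

text \<open>A pair i < j is encoded by its difference j - i and its smaller element i; only the
  differences 1 to n - 1 occur.\<close>

lemma choose_two_le_of_few_differences:
  fixes J :: "nat set"
  assumes J: "J \<subseteq> {..<n}"
    and few: "\<And>s. s > 0 \<Longrightarrow> card {i \<in> J. i + s \<in> J} \<le> m"
  shows "card J choose 2 \<le> (n - 1) * m"
proof -
  have "finite J"
    using J by (rule finite_subset) simp
  let ?P = "SIGMA s:{1..<n}. {i \<in> J. i + s \<in> J}"
  have ordered: "{i, j} \<in> (\<lambda>(s, i). {i, i + s}) ` ?P" if "i \<in> J" "j \<in> J" "i < j" for i j
    using that J by (intro image_eqI[of _ _ "(j - i, i)"]) auto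
  have "{K. K \<subseteq> J \<and> card K = 2} \<subseteq> (\<lambda>(s, i). {i, i + s}) ` ?P"
  proof
    fix K assume "K \<in> {K. K \<subseteq> J \<and> card K = 2}"
    then obtain i j where "K = {i, j}" "i \<noteq> j" "i \<in> J" "j \<in> J"
      by (auto simp: card_2_iff)
    then show "K \<in> (\<lambda>(s, i). {i, i + s}) ` ?P"
      using ordered[of i j] ordered[of j i] by (cases i j rule: linorder_cases) (auto simp: insert_commute)
  qed
  then have "card {K. K \<subseteq> J \<and> card K = 2} \<le> card ((\<lambda>(s, i). {i, i + s}) ` ?P)"
    by (rule card_mono[rotated]) (use \<open>finite J\<close> in simp)
  also have "\<dots> \<le> card ?P"
    by (rule card_image_le) (use \<open>finite J\<close> in simp)
  also have "card ?P = (\<Sum>s\<in>{1..<n}. card {i \<in> J. i + s \<in> J})"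
    using \<open>finite J\<close> by (intro card_SigmaI) auto
  also have "\<dots> \<le> (\<Sum>s\<in>{1..<n}. m)"
    by (intro sum_mono few) simp
  finally show ?thesis
    using \<open>finite J\<close> by (simp add: n_subsets)
qed

context coordinate_order
begin

lemma few_differences:
  fixes J :: "nat set"
  assumes "finite J" and distinct: "distinct_volumes (root_plane ` real ` J)" and "s > 0"
  shows "card {i \<in> J. i + s \<in> J} \<le> CARD('d)"
proof (rule ccontr)
  assume "\<not> ?thesis"
  then have "CARD('d) + 1 \<le> card {i \<in> J. i + s \<in> J}" by simp
  then obtain U where U: "U \<subseteq> {i \<in> J. i + s \<in> J}" "card U = CARD('d) + 1" "finite U"
    by (rule obtain_subset_with_card_n)
  let ?plane = "\<lambda>i::nat. root_plane (real i)"
  let ?S = "?plane ` U" and ?S' = "?plane ` (\<lambda>i. i + s) ` U"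
  have inj: "inj ?plane"
    using inj_compose[OF inj_root_plane inj_of_nat] by (simp add: o_def)
  have card: "card (?plane ` K) = card K" for K
    using inj by (intro card_image) (auto intro: inj_on_subset)
  have card': "card ((\<lambda>i. i + s) ` U) = card U"
    by (intro card_image) auto
  have S': "?S' = (`) (shift (real s)) ` ?S"
    by (simp add: image_image shift_root_plane)
  have "general_position (root_plane ` real ` U)"
    using U by (intro general_position_root_planes) (auto simp: card_image)
  then have "finite (simplex_vertices ?S)"
    by (rule finite_simplex_vertices) (simp add: image_image)
  then have "simplex_volume ?S' = simplex_volume ?S"
    unfolding S' simplex_volume_def
    by (simp add: simplex_vertices_image bij_shift measure_shift_convex_hull)
  moreover have "?S \<subseteq> root_plane ` real ` J" "?S' \<subseteq> root_plane ` real ` J"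
    using U(1) by auto
  \<comment> \<open>Both families have d + 1 members and equal volume, so distinctness of volumes
    forces them to coincide.\<close>
  ultimately have "?S' = ?S"
    using distinct U(2) unfolding distinct_volumes_def inj_on_def by (simp add: card card')
  then have eq: "(\<lambda>i. i + s) ` U = U"
    using inj by (simp add: inj_image_eq_iff)
  have "U \<noteq> {}"
    using U(2) by auto
  \<comment> \<open>A nonempty finite set of naturals is not invariant under a positive translation:
    its maximum would grow.\<close>
  then have "Max U + s \<in> U"
    using eq U(3) Max_in by blast
  then show False
    using Max_ge[OF U(3)] \<open>s > 0\<close> by (metis add_le_same_cancel1 not_le)
qed

lemma card_distinct_volumes_le:
  assumes "B \<subseteq> root_plane ` real ` {..<n}" "distinct_volumes B"
  shows "card B choose 2 \<le> (n - 1) * CARD('d)"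
proof -
  from assms(1) obtain R where R: "R \<subseteq> real ` {..<n}" "B = root_plane ` R"
    by (rule subset_imageE)
  from R(1) obtain J where "J \<subseteq> {..<n}" "R = real ` J"
    by (rule subset_imageE)
  with R(2) have J: "J \<subseteq> {..<n}" "B = root_plane ` real ` J" by simp_all
  have "finite J"
    using J(1) by (rule finite_subset) simp
  have "card B = card (real ` J)"
    unfolding J(2) by (intro card_image inj_on_subset[OF inj_root_plane] subset_UNIV)
  also have "\<dots> = card J"
    by (simp add: card_image)
  finally have "card B = card J" .
  moreover have "card J choose 2 \<le> (n - 1) * CARD('d)"
    using J(1) few_differences[OF \<open>finite J\<close>] assms(2)
    by (intro choose_two_le_of_few_differences) (auto simp: J(2))
  ultimately show ?thesis by simp
qed

end

section \<open>The extremal number and its asymptotic bound\<close>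

lemma D_witness:
  fixes A :: "(real ^ 'd::finite) set set"
  assumes "general_position A"
  shows "\<exists>B\<subseteq>A. card B = D TYPE('d) (card A) \<and> distinct_volumes B"
proof -
  let ?P = "\<lambda>t. \<forall>A' :: (real ^ 'd) set set. general_position A' \<and> card A' = card A \<longrightarrow>
    (\<exists>B. B \<subseteq> A' \<and> card B = t \<and> distinct_volumes B)"
  \<comment> \<open>The greatest value is attained once one value qualifies and all are bounded: the
    empty subset handles 0, and the given arrangement \<open>A\<close> bounds every qualifying
    \<open>t\<close> by its size.\<close>
  have "?P 0"
    by (intro allI impI exI[of _ "{}"]) (auto simp: distinct_volumes_def inj_on_def)
  moreover have "t \<le> card A" if "?P t" for t
  proof -
    have "finite A"
      using assms by (simp add: general_position_def)
    then show ?thesis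
      using that assms card_mono by blast
  qed
  ultimately have "?P (Greatest ?P)"
    by (rule GreatestI_nat)
  then show ?thesis
    using assms unfolding D_def by blast
qed

lemma D_choose_two_le:
  assumes "n \<ge> CARD('d::finite) + 1"
  shows "D TYPE('d) n choose 2 \<le> (n - 1) * CARD('d)"
proof -
  obtain r :: "'d \<Rightarrow> nat" where "bij_betw r UNIV {0..<CARD('d)}"
    using ex_bij_betw_finite_nat[of "UNIV :: 'd set"] by auto
  then interpret coordinate_order r
    by unfold_locales (simp add: atLeast0LessThan)
  let ?A = "root_plane ` real ` {..<n}"
  have card: "card (real ` {..<n}) = n"
    by (simp add: card_image)
  then have "general_position ?A"
    using assms by (intro general_position_root_planes) auto
  moreover have "card ?A = n"
    using inj_root_plane card by (metis card_image inj_on_subset subset_UNIV)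
  ultimately obtain B where "B \<subseteq> ?A" "card B = D TYPE('d) n" "distinct_volumes B"
    using D_witness[of ?A] by auto
  then show ?thesis
    using card_distinct_volumes_le by metis
qed

theorem theorem2:
  assumes "CARD('d::finite) \<ge> 2"
  shows "\<exists>\<epsilon> :: nat \<Rightarrow> real. \<epsilon> \<longlonglongrightarrow> 0 \<and>
    (\<forall>n \<ge> 2 * CARD('d) + 2.
       real (D TYPE('d) n) \<le> (1 + \<epsilon> n) * sqrt (2 * (real CARD('d) + 1) * real n))"
proof -
  let ?c = "2 * (real CARD('d) + 1)"
  \<comment> \<open>Chosen so that (1 + 1/S) S = S + 1, where S is the square root in the
    bound.\<close>
  let ?\<epsilon> = "\<lambda>n. 1 / sqrt (?c * real n)"
  have "filterlim (\<lambda>n. ?c * real n) at_top sequentially"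
    by (rule filterlim_tendsto_pos_mult_at_top[OF tendsto_const _ filterlim_real_sequentially]) simp
  from tendsto_inverse_0_at_top[OF filterlim_compose[OF sqrt_at_top this]]
  have lim: "?\<epsilon> \<longlonglongrightarrow> 0"
    by (simp only: inverse_eq_divide)
  have bound: "real (D TYPE('d) n) \<le> (1 + ?\<epsilon> n) * sqrt (?c * real n)" if n: "n \<ge> 2 * CARD('d) + 2" for n
  proof -
    define t where "t = D TYPE('d) n"
    have "t choose 2 \<le> (n - 1) * CARD('d)"
      unfolding t_def using n by (intro D_choose_two_le) simp
    moreover have "even (t * (t - 1))"
      by (cases t) auto
    then have "t * (t - 1) = 2 * (t choose 2)"
      by (simp add: choose_two)
    ultimately have "t * (t - 1) \<le> 2 * ((n - 1) * CARD('d))" by simp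
    also have "\<dots> \<le> 2 * (n * CARD('d))"
      by simp
    finally have "real (t * (t - 1)) \<le> real (2 * (n * CARD('d)))"
      by (simp only: of_nat_le_iff)
    \<comment> \<open>The summand 1 covers t = 0, where the left side is 1 and the product is 0. It
      is absorbed by passing from 2dn to 2(d + 1)n.\<close>
    moreover have "(real t - 1)\<^sup>2 \<le> real (t * (t - 1)) + 1"
      by (cases t) (auto simp: power2_eq_square algebra_simps)
    ultimately have "(real t - 1)\<^sup>2 \<le> ?c * real n"
      using n by (simp add: algebra_simps)
    moreover define S where "S = sqrt (?c * real n)"
    ultimately have "real t \<le> S + 1"
      using real_le_rsqrt by fastforce
    moreover have "S > 0"
      unfolding S_def using n by (intro real_sqrt_gt_zero mult_pos_pos) auto
    then have "S + 1 = (1 + 1 / S) * S"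
      by (simp add: field_simps)
    ultimately show ?thesis
      unfolding t_def S_def by simp
  qed
  show ?thesis
    using lim bound by (intro exI[of _ ?\<epsilon>]) blast
qed

end
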